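(* Let $K$ be a positive integer and let $z_1,\dots,z_K$ be mutually uncorrelated real random variables with non-zero and pairwise unequal variances; write $\mathbf z=(z_1,\dots,z_K)^\top$. Let $\mathbf e=\mathbf D\mathbf z$, where $\mathbf D\in\mathbb R^{K\times K}$ is an orthonormal matrix (i.e. $\mathbf D^\top\mathbf D=\mathbf I$). If $\mathbf M\in\mathbb R^{K\times K}$ is an orthonormal matrix such that the components of $\mathbf z'=(z'_1,\dots,z'_K)^\top=\mathbf M\mathbf e$ are mutually uncorrelated, then $\mathbf M\mathbf e=\mathbf P\mathbf S\mathbf z$ for some permutation matrix $\mathbf P\in\mathbb R^{K\times K}$ and some diagonal matrix $\mathbf S\in\mathbb R^{K\times K}$ with $|s_{ii}|=1$ for all $i\in\{1,\dots,K\}$.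
   Context: All variances are understood to be finite. A permutation matrix has exactly one entry $1$ in each row and each column and zeros elsewhere. *)

theory Defs
  imports "HOL-Probability.Probability"
begin

definition has_finite_variance :: "'a measure \<Rightarrow> ('a \<Rightarrow> real) \<Rightarrow> bool" where
  "has_finite_variance N X \<longleftrightarrow>
     integrable N X \<and> integrable N (\<lambda>\<omega>. (X \<omega> - prob_space.expectation N X)\<^sup>2)"

definition covariance :: "'a measure \<Rightarrow> ('a \<Rightarrow> real) \<Rightarrow> ('a \<Rightarrow> real) \<Rightarrow> real" where
  "covariance N X Y =
     prob_space.expectation N
       (\<lambda>\<omega>. (X \<omega> - prob_space.expectation N X) * (Y \<omega> - prob_space.expectation N Y))"

(* The Bochner integral of a non-integrable function is 0, so "covariance 0" is meaningful
   only for components of finite variance; that is not part of this definition. *)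
definition mutually_uncorrelated :: "'a measure \<Rightarrow> ('a \<Rightarrow> real ^ 'k) \<Rightarrow> bool" where
  "mutually_uncorrelated N X \<longleftrightarrow>
     (\<forall>i j. i \<noteq> j \<longrightarrow> covariance N (\<lambda>\<omega>. X \<omega> $ i) (\<lambda>\<omega>. X \<omega> $ j) = 0)"

definition permutation_matrix :: "real ^ 'k ^ 'k \<Rightarrow> bool" where
  "permutation_matrix P \<longleftrightarrow>
     (\<forall>i j. P $ i $ j = 0 \<or> P $ i $ j = 1) \<and>
     (\<forall>i. \<exists>!j. P $ i $ j = 1) \<and> (\<forall>j. \<exists>!i. P $ i $ j = 1)"

definition diagonal_matrix :: "real ^ 'k ^ 'k \<Rightarrow> bool" where
  "diagonal_matrix S \<longleftrightarrow> (\<forall>i j. i \<noteq> j \<longrightarrow> S $ i $ j = 0)"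

end

theory Submission
  imports Defs
begin

text \<open>
  With \<open>Q = M D\<close> and \<open>V\<close> the diagonal covariance matrix of \<open>z\<close>, the covariance matrix of
  \<open>M e = Q z\<close> is \<open>Q V Q\<^sup>T\<close>. If it is a diagonal matrix \<open>L\<close>, then \<open>Q V = L Q\<close>, that is
  \<open>Q\<^sub>i\<^sub>k v\<^sub>k = l\<^sub>i Q\<^sub>i\<^sub>k\<close>. As the \<open>v\<^sub>k\<close> are distinct, each row of \<open>Q\<close> has at most one non-zero
  entry, so \<open>Q\<close>, being orthogonal, is a signed permutation matrix.
\<close>

text \<open>By \<open>\<bar>x * y\<bar> \<le> x\<^sup>2 + y\<^sup>2\<close> the sum of the squares
  is an integrable majorant. This is what makes products of centred variables of finite variance
  integrable.\<close>

lemma integrable_mult_of_squares: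
  fixes X Y :: "'a \<Rightarrow> real"
  assumes "X \<in> borel_measurable N" "Y \<in> borel_measurable N"
    and "integrable N (\<lambda>\<omega>. (X \<omega>)\<^sup>2)" "integrable N (\<lambda>\<omega>. (Y \<omega>)\<^sup>2)"
  shows "integrable N (\<lambda>\<omega>. X \<omega> * Y \<omega>)"
proof (rule Bochner_Integration.integrable_bound)
  show "integrable N (\<lambda>\<omega>. (X \<omega>)\<^sup>2 + (Y \<omega>)\<^sup>2)"
    using assms by simp
  show "(\<lambda>\<omega>. X \<omega> * Y \<omega>) \<in> borel_measurable N"
    using assms by simp
  have "\<bar>x * y\<bar> \<le> x\<^sup>2 + y\<^sup>2" for x y :: real
  proof -
    have "2 * (\<bar>x\<bar> * \<bar>y\<bar>) \<le> x\<^sup>2 + y\<^sup>2"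
      using sum_squares_bound[of "\<bar>x\<bar>" "\<bar>y\<bar>"] by simp
    moreover have "0 \<le> \<bar>x\<bar> * \<bar>y\<bar>" by simp
    ultimately show ?thesis unfolding abs_mult by linarith
  qed
  then show "AE \<omega> in N. norm (X \<omega> * Y \<omega>) \<le> norm ((X \<omega>)\<^sup>2 + (Y \<omega>)\<^sup>2)"
    by simp
qed

text \<open>The relation between \<open>e\<close> and \<open>z\<close> is given only on
  \<open>space N\<close>, so rewriting \<open>M *v e \<omega>\<close> under a covariance needs this
  congruence instead of an equality of functions.\<close>

lemma covariance_cong:
  assumes "\<And>\<omega>. \<omega> \<in> space N \<Longrightarrow> X \<omega> = X' \<omega>" "\<And>\<omega>. \<omega> \<in> space N \<Longrightarrow> Y \<omega> = Y' \<omega>"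
  shows "covariance N X Y = covariance N X' Y'"
proof -
  have "integral\<^sup>L N X = integral\<^sup>L N X'" "integral\<^sup>L N Y = integral\<^sup>L N Y'"
    using assms by (auto intro: Bochner_Integration.integral_cong)
  then show ?thesis
    unfolding covariance_def using assms by (auto intro: Bochner_Integration.integral_cong)
qed

lemma covariance_self:
  "covariance N X X = prob_space.variance N X"
  by (simp add: covariance_def power2_eq_square)

text \<open>Centring commutes with linear combinations, so the product of the two centred sums
  expands into a double sum of the products \<open>Y k \<omega> * Y l \<omega>\<close>. Finite
  variance makes each of them integrable, which lets the integral pass through the sums.\<close>

lemma covariance_sum_sum:
  fixes X :: "'i \<Rightarrow> 'a \<Rightarrow> real"
  assumes "\<And>k. k \<in> A \<Longrightarrow> has_finite_variance N (X k)"
  shows "covariance N (\<lambda>\<omega>. \<Sum>k\<in>A. a k * X k \<omega>) (\<lambda>\<omega>. \<Sum>k\<in>A. b k * X k \<omega>)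
    = (\<Sum>k\<in>A. \<Sum>l\<in>A. a k * b l * covariance N (X k) (X l))"
proof -
  define Y where "Y k \<omega> = X k \<omega> - integral\<^sup>L N (X k)" for k \<omega>
  have int: "integrable N (X k)" if "k \<in> A" for k
    using assms[OF that] by (simp add: has_finite_variance_def)
  have intY: "integrable N (\<lambda>\<omega>. Y k \<omega> * Y l \<omega>)" if "k \<in> A" "l \<in> A" for k l
    using assms[OF that(1)] assms[OF that(2)] unfolding Y_def
    by (intro integrable_mult_of_squares) (auto simp: has_finite_variance_def)
  have centred: "(\<Sum>k\<in>A. c k * X k \<omega>) - integral\<^sup>L N (\<lambda>\<omega>. \<Sum>k\<in>A. c k * X k \<omega>) =
      (\<Sum>k\<in>A. c k * Y k \<omega>)" for c \<omega>
    using int by (simp add: Y_def right_diff_distrib sum_subtractf)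
  have "covariance N (\<lambda>\<omega>. \<Sum>k\<in>A. a k * X k \<omega>) (\<lambda>\<omega>. \<Sum>k\<in>A. b k * X k \<omega>)
      = (\<integral>\<omega>. (\<Sum>k\<in>A. \<Sum>l\<in>A. a k * b l * (Y k \<omega> * Y l \<omega>)) \<partial>N)"
    unfolding covariance_def centred sum_product by (simp add: mult_ac)
  also have "\<dots> = (\<Sum>k\<in>A. \<Sum>l\<in>A. a k * b l * (\<integral>\<omega>. Y k \<omega> * Y l \<omega> \<partial>N))"
    using intY by (simp add: integral_sum integrable_sum)
  finally show ?thesis
    by (simp add: covariance_def Y_def)
qed

lemma orthogonal_matrix_sum_columns:
  fixes Q :: "real ^ 'k ^ 'k"
  assumes "orthogonal_matrix Q"
  shows "(\<Sum>i\<in>UNIV. Q $ i $ k * Q $ i $ l) = (if k = l then 1 else 0)"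
proof -
  have "(transpose Q ** Q) $ k $ l = (mat 1 :: real ^ 'k ^ 'k) $ k $ l"
    using assms by (simp add: orthogonal_matrix_def)
  then show ?thesis
    by (simp add: matrix_matrix_mult_def transpose_def mat_def)
qed

lemma orthogonal_matrix_sum_rows:
  fixes Q :: "real ^ 'k ^ 'k"
  assumes "orthogonal_matrix Q"
  shows "(\<Sum>k\<in>UNIV. Q $ i $ k * Q $ j $ k) = (if i = j then 1 else 0)"
proof -
  have "orthogonal_matrix (transpose Q)"
    using assms by (simp add: orthogonal_matrix_def)
  from orthogonal_matrix_sum_columns[OF this, of i j] show ?thesis
    by (simp add: transpose_def)
qed

lemma orthogonal_diagonalizing_row_unique:
  fixes Q :: "real ^ 'k ^ 'k" and v :: "'k \<Rightarrow> real"
  assumes Q: "orthogonal_matrix Q" and v: "inj v"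
    and diag: "\<And>i j. i \<noteq> j \<Longrightarrow> (\<Sum>k\<in>UNIV. Q $ i $ k * Q $ j $ k * v k) = 0"
    and nz: "Q $ i $ k \<noteq> 0" "Q $ i $ l \<noteq> 0"
  shows "k = l"
proof -
  \<comment> \<open>\<open>C j\<close> is the entry in row \<open>i\<close> and column
    \<open>j\<close> of \<open>Q V Q\<^sup>T\<close>, where \<open>V\<close> is the diagonal matrix
    of the \<open>v m\<close>. By \<open>diag\<close> it vanishes for \<open>j\<close> other than
    \<open>i\<close>.\<close>
  define C where "C j = (\<Sum>m\<in>UNIV. Q $ i $ m * Q $ j $ m * v m)" for j
  have "Q $ i $ m * v m = C i * Q $ i $ m" for m
  proof -
    \<comment> \<open>Row \<open>i\<close> of \<open>(Q V Q\<^sup>T) Q\<close> is evaluated twice: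
      here orthonormality of the columns reduces it to row \<open>i\<close> of \<open>Q V\<close>;
      afterwards the vanishing of the off-diagonal \<open>C j\<close> leaves only the term
      \<open>j = i\<close>.\<close>
    have "(\<Sum>j\<in>UNIV. C j * Q $ j $ m) =
        (\<Sum>n\<in>UNIV. Q $ i $ n * v n * (\<Sum>j\<in>UNIV. Q $ j $ n * Q $ j $ m))"
      unfolding C_def sum_distrib_left sum_distrib_right
      by (subst sum.swap) (simp add: mult_ac)
    also have "\<dots> = Q $ i $ m * v m"
      by (simp add: orthogonal_matrix_sum_columns[OF Q] if_distrib sum.delta cong: if_cong)
    finally have "Q $ i $ m * v m = (\<Sum>j\<in>UNIV. C j * Q $ j $ m)" ..
    also have "\<dots> = (\<Sum>j\<in>UNIV. if j = i then C i * Q $ i $ m else 0)"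
      using diag by (intro sum.cong) (auto simp: C_def)
    finally show ?thesis by simp
  qed
  with nz have "v k = C i" "v l = C i"
    by (metis mult.commute mult_cancel_left)+
  with v show ?thesis by (metis injD)
qed

text \<open>Two rows with non-zero entries in a common column would have a non-zero inner product,
  so columns inherit the sparsity of rows. Unit length of rows and columns then forces a non-zero
  entry in each, of modulus 1.\<close>

lemma orthogonal_monomial_decomposition:
  fixes Q :: "real ^ 'k ^ 'k"
  assumes Q: "orthogonal_matrix Q"
    and row: "\<And>i k l. Q $ i $ k \<noteq> 0 \<Longrightarrow> Q $ i $ l \<noteq> 0 \<Longrightarrow> k = l"
  obtains P S where "permutation_matrix P" "diagonal_matrix S" "\<And>i. \<bar>S $ i $ i\<bar> = 1" "Q = P ** S"
proof -
  have col: "i = j" if "Q $ i $ k \<noteq> 0" "Q $ j $ k \<noteq> 0" for i j k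
  proof (rule ccontr)
    assume "i \<noteq> j"
    \<comment> \<open>By \<open>row\<close>, both rows vanish outside column \<open>k\<close>, so a
      single non-zero term is left, against orthogonality.\<close>
    have "(\<Sum>m\<in>UNIV. Q $ i $ m * Q $ j $ m)
        = (\<Sum>m\<in>UNIV. if m = k then Q $ i $ k * Q $ j $ k else 0)"
      using row that by (intro sum.cong) auto
    with \<open>i \<noteq> j\<close> that show False
      by (simp add: orthogonal_matrix_sum_rows[OF Q])
  qed
  have ex_row: "\<exists>k. Q $ i $ k \<noteq> 0" for i
  proof (rule ccontr)
    assume "\<not> ?thesis"
    then show False
      using orthogonal_matrix_sum_rows[OF Q, of i i] by simp
  qed
  have ex_col: "\<exists>i. Q $ i $ k \<noteq> 0" for k
  proof (rule ccontr)
    assume "\<not> ?thesis"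
    then show False
      using orthogonal_matrix_sum_columns[OF Q, of k k] by simp
  qed
  have unit: "\<bar>Q $ i $ k\<bar> = 1" if "Q $ i $ k \<noteq> 0" for i k
  proof -
    have "(\<Sum>m\<in>UNIV. Q $ i $ m * Q $ i $ m)
        = (\<Sum>m\<in>UNIV. if m = k then Q $ i $ k * Q $ i $ k else 0)"
      using row that by (intro sum.cong) auto
    then have "(Q $ i $ k)\<^sup>2 = 1"
      by (simp add: orthogonal_matrix_sum_rows[OF Q] power2_eq_square)
    then show ?thesis by (simp add: abs_square_eq_1)
  qed
  \<comment> \<open>Absolute values give the pattern of \<open>P\<close>. The signs go into the
    right factor and are thus indexed by columns: a column sum of \<open>Q\<close> equals its only
    non-zero entry, so no row has to be chosen.\<close>
  define P :: "real ^ 'k ^ 'k" where "P = (\<chi> i k. \<bar>Q $ i $ k\<bar>)"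
  define S :: "real ^ 'k ^ 'k" where "S = (\<chi> k l. if k = l then \<Sum>i\<in>UNIV. Q $ i $ k else 0)"
  have S: "S $ k $ k = Q $ i $ k" if "Q $ i $ k \<noteq> 0" for i k
  proof -
    have "(\<Sum>j\<in>UNIV. Q $ j $ k) = (\<Sum>j\<in>UNIV. if j = i then Q $ i $ k else 0)"
      using col that by (intro sum.cong) auto
    then show ?thesis by (simp add: S_def)
  qed
  have P_iff: "P $ i $ k = 1 \<longleftrightarrow> Q $ i $ k \<noteq> 0" for i k
    using unit by (auto simp: P_def)
  have "permutation_matrix P"
    unfolding permutation_matrix_def
  proof (intro conjI allI)
    show "P $ i $ k = 0 \<or> P $ i $ k = 1" for i k
      using unit[of i k] by (auto simp: P_def)
    show "\<exists>!k. P $ i $ k = 1" for i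
      unfolding P_iff using ex_row[of i] row[of i] by blast
    show "\<exists>!i. P $ i $ k = 1" for k
      unfolding P_iff using ex_col[of k] col[of _ k] by blast
  qed
  moreover have "diagonal_matrix S"
    by (simp add: diagonal_matrix_def S_def)
  moreover have "\<bar>S $ k $ k\<bar> = 1" for k
    proof -
    obtain i where "Q $ i $ k \<noteq> 0" using ex_col by blast
    then show ?thesis using S unit by simp
  qed
  moreover have "Q = P ** S"
  proof -
    have "(P ** S) $ i $ k = Q $ i $ k" for i k
    proof -
      have "(P ** S) $ i $ k = (\<Sum>m\<in>UNIV. if m = k then P $ i $ k * S $ k $ k else 0)"
        unfolding matrix_matrix_mult_def vec_lambda_beta
        by (rule sum.cong) (simp_all add: S_def)
      also have "\<dots> = \<bar>Q $ i $ k\<bar> * S $ k $ k"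
        by (simp add: P_def)
      \<comment> \<open>Where \<open>Q $ i $ k\<close> is non-zero, it equals
        \<open>S $ k $ k\<close> and its absolute value is 1; elsewhere both sides are 0.\<close>
      also have "\<dots> = Q $ i $ k"
        using S[of i k] unit[of i k] by (cases "Q $ i $ k = 0") auto
      finally show ?thesis .
    qed
    then show ?thesis by (simp add: vec_eq_iff)
  qed
  ultimately show thesis by (rule that)
qed

theorem theorem3p1:
  fixes N :: "'a measure"
    and z e :: "'a \<Rightarrow> real ^ 'k"
    and D M :: "real ^ 'k ^ 'k"
  assumes "prob_space N"
    and "\<And>i. has_finite_variance N (\<lambda>\<omega>. z \<omega> $ i)"
    and "mutually_uncorrelated N z"
    and "\<And>i. prob_space.variance N (\<lambda>\<omega>. z \<omega> $ i) \<noteq> 0"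
    and "\<And>i j. i \<noteq> j \<Longrightarrow>
           prob_space.variance N (\<lambda>\<omega>. z \<omega> $ i) \<noteq> prob_space.variance N (\<lambda>\<omega>. z \<omega> $ j)"
    and "orthogonal_matrix D"
    and "\<And>\<omega>. \<omega> \<in> space N \<Longrightarrow> e \<omega> = D *v z \<omega>"
    and "orthogonal_matrix M"
    and "mutually_uncorrelated N (\<lambda>\<omega>. M *v e \<omega>)"
  shows "\<exists>P S :: real ^ 'k ^ 'k.
           permutation_matrix P \<and> diagonal_matrix S \<and> (\<forall>i. \<bar>S $ i $ i\<bar> = 1) \<and>
           (\<forall>\<omega>\<in>space N. M *v e \<omega> = (P ** S) *v z \<omega>)"
proof -
  define Q where "Q = M ** D"
  define v where "v k = prob_space.variance N (\<lambda>\<omega>. z \<omega> $ k)" for k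
  have Q: "orthogonal_matrix Q"
    unfolding Q_def by (rule orthogonal_matrix_mul) fact+
  have Me: "M *v e \<omega> = Q *v z \<omega>" if "\<omega> \<in> space N" for \<omega>
    using assms(7)[OF that] by (simp add: Q_def matrix_vector_mul_assoc)
  have "inj v"
    using assms(5) unfolding v_def inj_def by blast
  \<comment> \<open>The test is written as \<open>l = k\<close> to match \<open>sum.delta\<close>
    when the inner sum over \<open>l\<close> is collapsed in \<open>diag\<close>.\<close>
  have cov: "covariance N (\<lambda>\<omega>. z \<omega> $ k) (\<lambda>\<omega>. z \<omega> $ l) = (if l = k then v k else 0)" for k l
    using assms(3) by (auto simp: mutually_uncorrelated_def covariance_self v_def)
  have diag: "(\<Sum>k\<in>UNIV. Q $ i $ k * Q $ j $ k * v k) = 0" if "i \<noteq> j" for i j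
  proof -
    have "0 = covariance N (\<lambda>\<omega>. (M *v e \<omega>) $ i) (\<lambda>\<omega>. (M *v e \<omega>) $ j)"
      using assms(9) that by (simp add: mutually_uncorrelated_def)
    also have "\<dots> = covariance N (\<lambda>\<omega>. \<Sum>k\<in>UNIV. Q $ i $ k * z \<omega> $ k)
        (\<lambda>\<omega>. \<Sum>k\<in>UNIV. Q $ j $ k * z \<omega> $ k)"
      by (rule covariance_cong) (simp_all only: Me, simp_all add: matrix_vector_mult_def)
    also have "\<dots> = (\<Sum>k\<in>UNIV. \<Sum>l\<in>UNIV. Q $ i $ k * Q $ j $ l * (if l = k then v k else 0))"
      using assms(2) by (subst covariance_sum_sum) (simp_all add: cov)
    also have "\<dots> = (\<Sum>k\<in>UNIV. Q $ i $ k * Q $ j $ k * v k)"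
      by (simp add: if_distrib sum.delta cong: if_cong)
    finally show ?thesis ..
  qed
  have row: "k = l" if "Q $ i $ k \<noteq> 0" "Q $ i $ l \<noteq> 0" for i k l
    by (rule orthogonal_diagonalizing_row_unique[OF Q \<open>inj v\<close> diag that])
  obtain P S where "permutation_matrix P" "diagonal_matrix S" "\<And>i. \<bar>S $ i $ i\<bar> = 1" "Q = P ** S"
    by (rule orthogonal_monomial_decomposition[OF Q row]) blast+
  with Me show ?thesis by blast
qed

end
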